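(* Suppose that each agent $i\in\mathcal N$ independently draws a multi-sample $\boldsymbol\xi_i\in\Xi^{K_i}$, and let $\boldsymbol\xi=(\boldsymbol\xi_i)_{i=1}^N\in\Xi^K$, $K=\sum_{i\in\mathcal N}K_i$. Fix $\beta\in(0,1)$ and choose $\beta_i>0$, $i\in\mathcal N$, such that $\sum_{i\in\mathcal N}\beta_i=\beta$. For each $i\in\mathcal N$ let $\epsilon_i:\{0,1,\dots,K_i\}\to[0,1]$ be a function satisfying $$\epsilon_i(K_i)=1,\qquad \sum_{k=0}^{K_i-1}\binom{K_i}{k}\bigl(1-\epsilon_i(k)\bigr)^{K_i-k}=\beta_i .$$ Consider the algorithm that takes $\boldsymbol\xi$ as input and returns the scenario core $C(G_K)$, together with a rule selecting, for each $\boldsymbol\xi$, a compression set for $\boldsymbol\xi$; let $s_{i,K}$ be the (multi-sample dependent) number of elements of this compression set that are samples of agent $i$. Then $$\mathbb P^K\Bigl\{\boldsymbol\xi\in\Xi^K:\ \mathbb V(C(G_K))\le\sum_{i\in\mathcal N}\epsilon_i(s_{i,K})\Bigr\}\ \ge\ 1-\beta .$$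
   Context: Setting. $\mathcal N=\{1,\dots,N\}$ is the set of agents. $\Xi$ is the uncertainty set, endowed with an (unknown) probability measure $\mathbb P$. For every nonempty coalition $S\subset\mathcal N$ (throughout, $\subset$ denotes proper inclusion, so $S\neq\mathcal N$) there is a value function $u_S:\Xi\to\mathbb R$; the value of the grand coalition is a deterministic number $u_{\mathcal N}\in\mathbb R$. An allocation is a vector $\boldsymbol x=(x_i)_{i\in\mathcal N}\in\mathbb R^N$. Private sampling. Each agent $i$ draws $\boldsymbol\xi_i=(\xi_i^{(1)},\dots,\xi_i^{(K_i)})\in\Xi^{K_i}$, consisting of $K_i$ independent samples from $\mathbb P$; samples of different agents are independent. Thus $\boldsymbol\xi=(\boldsymbol\xi_i)_{i\in\mathcal N}$ has law $\mathbb P^K$ (the $K$-fold product measure) on $\Xi^K$. Scenario core with private sampling: $$C(G_K)=\Bigl\{\boldsymbol x\in\mathbb R^N:\ \sum_{i\in\mathcal N}x_i=u_{\mathcal N}\ \text{ and }\ \sum_{i\in S}x_i\ge\max_{i\in S}\max_{k=1,\dots,K_i}u_S(\xi_i^{(k)})\ \ \forall S\subset\mathcal N\Bigr\}.$$ Standing assumption: $C(G_K)$ is nonempty for every $\boldsymbol\xi\in\Xi^K$. Probability of core instability: $\mathbb V(C(G_K))=\mathbb P\{\xi\in\Xi:\ \exists\,\boldsymbol x\in C(G_K),\ \exists\,S\subset\mathcal N:\ \sum_{i\in S}x_i<u_S(\xi)\}$. Compression set. A subset $I$ of the samples in $\boldsymbol\xi$ (each sample keeping its label $(i,k)$, i.e.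 the agent to which it belongs) is a compression set for $\boldsymbol\xi$ if the scenario core computed using only the samples in $I$ coincides with the one computed using all of $\boldsymbol\xi$, that is, if $\{\boldsymbol x\in\mathbb R^N:\sum_{i\in\mathcal N}x_i=u_{\mathcal N},\ \sum_{j\in S}x_j\ge u_S(\xi_i^{(k)})\ \text{for all }\xi_i^{(k)}\in I\text{ and all }S\subset\mathcal N\text{ with }i\in S\}=C(G_K)$ (this is required for $\mathbb P^K$-almost every $\boldsymbol\xi$). *)

theory Defs
  imports "HOL-Probability.Probability"
begin

text \<open>
  The agents are the elements of a finite type \<open>'n\<close>, so the set of all agents is \<open>UNIV\<close> and an
  allocation is a vector in \<open>real ^ 'n\<close>.  The uncertainty set with its probability measure is
  a probability space \<open>M\<close>.  The value functions of the proper coalitions are \<open>u\<close>; the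
  deterministic value of the grand coalition is the separate parameter \<open>uN\<close> (the value of
  \<open>u UNIV\<close> is never used).
\<close>

definition proper_coalitions :: "'n::finite set set" where
  "proper_coalitions = {S. S \<noteq> {} \<and> S \<subset> UNIV}"

text \<open>
  The label \<open>(i, k)\<close> stands for the \<open>k\<close>-th sample of agent \<open>i\<close>.  A multi-sample is a function
  on labels, so equal sample values with different labels are different samples.
\<close>

definition sample_labels :: "('n::finite \<Rightarrow> nat) \<Rightarrow> ('n \<times> nat) set" where
  "sample_labels K = (SIGMA i:UNIV. {1..K i})"

definition multisample_measure ::
    "'a measure \<Rightarrow> ('n::finite \<Rightarrow> nat) \<Rightarrow> ('n \<times> nat \<Rightarrow> 'a) measure" where
  "multisample_measure M K = PiM (sample_labels K) (\<lambda>_. M)"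

text \<open>Both maxima are over nonempty finite sets as soon as every \<open>K i\<close> is positive.\<close>

definition scenario_core ::
    "('n::finite set \<Rightarrow> 'a \<Rightarrow> real) \<Rightarrow> real \<Rightarrow> ('n \<Rightarrow> nat) \<Rightarrow> ('n \<times> nat \<Rightarrow> 'a) \<Rightarrow> (real ^ 'n) set" where
  "scenario_core u uN K \<xi> =
     {x. (\<Sum>i\<in>UNIV. x $ i) = uN \<and>
         (\<forall>S\<in>proper_coalitions. (\<Sum>i\<in>S. x $ i) \<ge> (MAX i\<in>S. MAX k\<in>{1..K i}. u S (\<xi> (i, k))))}"

text \<open>The scenario core computed from the samples with labels in \<open>I\<close> only.\<close>

definition restricted_core ::
    "('n::finite set \<Rightarrow> 'a \<Rightarrow> real) \<Rightarrow> real \<Rightarrow> ('n \<times> nat) set \<Rightarrow> ('n \<times> nat \<Rightarrow> 'a) \<Rightarrow> (real ^ 'n) set" where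
  "restricted_core u uN I \<xi> =
     {x. (\<Sum>i\<in>UNIV. x $ i) = uN \<and>
         (\<forall>(i, k)\<in>I. \<forall>S\<in>proper_coalitions. i \<in> S \<longrightarrow> (\<Sum>j\<in>S. x $ j) \<ge> u S (\<xi> (i, k)))}"

definition core_instability ::
    "'a measure \<Rightarrow> ('n::finite set \<Rightarrow> 'a \<Rightarrow> real) \<Rightarrow> (real ^ 'n) set \<Rightarrow> real" where
  "core_instability M u C =
     measure M {\<omega> \<in> space M. \<exists>x\<in>C. \<exists>S\<in>proper_coalitions. (\<Sum>i\<in>S. x $ i) < u S \<omega>}"

definition agent_count :: "('n::finite \<times> nat) set \<Rightarrow> 'n \<Rightarrow> nat" where
  "agent_count I i = card {k. (i, k) \<in> I}"

end

theory Submission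
  imports Defs
begin

text \<open>
  A violated coalition contains some agent \<open>i\<close>, so the instability is at most the sum over \<open>i\<close> of the
  probability that a coalition containing \<open>i\<close> is violated.  For a single agent \<open>i\<close>, enlarge the
  compression set by all samples of the other agents; by monotonicity it still reproduces the core.
  For each fixed index set \<open>I\<close> of retained samples of agent \<open>i\<close>, the core computed from the kept
  samples is independent of the \<open>K i - card I\<close> discarded ones, none of which violates it; so this
  happens together with a violation probability above \<open>\<epsilon> i (card I)\<close> with probability at most
  \<open>(1 - \<epsilon> i (card I)) ^ (K i - card I)\<close>.  Summing over \<open>I\<close> gives \<open>b i\<close>, and summing over \<open>i\<close> gives \<open>\<beta>\<close>.

  Measurability rests on the fact that the set of right-hand sides for which the core is violated is
  the projection of a \<open>\<sigma>\<close>-compact polyhedron, hence Borel.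
\<close>


section \<open>Measurability of core violation\<close>

text \<open>The family \<open>\<S>\<close> is a parameter because two instances occur: all proper
  coalitions, which gives the core instability, and the proper coalitions that contain one fixed
  agent.\<close>

definition core_violated ::
    "('n::finite set \<Rightarrow> 'a \<Rightarrow> real) \<Rightarrow> (real ^ 'n) set \<Rightarrow> 'n set set \<Rightarrow> 'a \<Rightarrow> bool" where
  "core_violated u C \<S> \<omega> \<longleftrightarrow> (\<exists>x\<in>C. \<exists>S\<in>\<S>. (\<Sum>i\<in>S. x $ i) < u S \<omega>)"

text \<open>A projection of a closed set need not be closed, but a closed set is a countable union
  of compact sets, and these have compact images.\<close>

lemma borel_fst_image_closed:
  fixes F :: "('a::euclidean_space \<times> 'b::euclidean_space) set"
  assumes "closed F"
  shows "fst ` F \<in> sets borel"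
proof -
  obtain C :: "nat \<Rightarrow> ('a \<times> 'b) set" where C: "\<And>n. compact (C n)" "(\<Union>n. C n) = F"
    using closed_Union_compact_subsets[OF assms] by metis
  have "compact (fst ` C n)" for n
    by (intro compact_continuous_image C(1) continuous_intros)
  then have "(\<Union>n. fst ` C n) \<in> sets borel"
    by (intro sets.countable_UN) (auto intro: borel_closed compact_imp_closed)
  then show ?thesis
    using C(2) by (simp add: image_UN[symmetric])
qed

text \<open>The strict inequality destroys closedness. Demanding a slack of 1/(n+1) instead gives
  closed sets \<open>F n\<close>, whose projections are Borel and exhaust the set as n grows. The
  lower bounds \<open>m\<close> are indexed by coalitions, so that they form a vector in a Euclidean
  space.\<close>

lemma borel_strict_polyhedron_projection:
  fixes c :: real and \<T> :: "'n::finite set set" and S :: "'n set"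
  shows "{(m, w). \<exists>x::real^'n. (\<Sum>i\<in>UNIV. x $ i) = c \<and> (\<forall>T\<in>\<T>. m $ T \<le> (\<Sum>i\<in>T. x $ i)) \<and>
            (\<Sum>i\<in>S. x $ i) < w} \<in> sets (borel :: ((real^'n set) \<times> real) measure)"
    (is "?D \<in> _")
proof -
  define F where "F n = {z :: ((real^'n set) \<times> real) \<times> (real^'n).
      (\<Sum>i\<in>UNIV. snd z $ i) = c \<and> (\<forall>T\<in>\<T>. fst (fst z) $ T \<le> (\<Sum>i\<in>T. snd z $ i)) \<and>
      (\<Sum>i\<in>S. snd z $ i) + inverse (real (Suc n)) \<le> snd (fst z)}" for n
  have "closed (F n)" for n
    unfolding F_def Ball_def
    by (intro closed_Collect_conj closed_Collect_all closed_Collect_imp closed_Collect_le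
        closed_Collect_eq continuous_intros) auto
  then have "(\<Union>n. fst ` F n) \<in> sets borel"
    by (intro sets.countable_UN) (auto intro: borel_fst_image_closed)
  moreover have "?D = (\<Union>n. fst ` F n)"
  proof (intro set_eqI iffI)
    fix p assume "p \<in> ?D"
    then obtain m w x where p: "p = (m, w)" and x: "(\<Sum>i\<in>UNIV. x $ i) = c"
      "\<forall>T\<in>\<T>. m $ T \<le> (\<Sum>i\<in>T. x $ i)" and less: "(\<Sum>i\<in>S. x $ i) < w"
      by auto
    obtain n where "inverse (real (Suc n)) < w - (\<Sum>i\<in>S. x $ i)"
      using reals_Archimedean less by (metis diff_gt_0_iff_gt)
    then have "((m, w), x) \<in> F n"
      using x by (auto simp: F_def)
    then show "p \<in> (\<Union>n. fst ` F n)"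
      unfolding p by force
  next
    fix p assume "p \<in> (\<Union>n. fst ` F n)"
    then obtain n m w x where p: "p = (m, w)" and F: "((m, w), x) \<in> F n"
      by auto
    have "0 < inverse (real (Suc n))" by simp
    moreover have "(\<Sum>i\<in>S. x $ i) + inverse (real (Suc n)) \<le> w"
      using F by (simp add: F_def del: of_nat_Suc)
    ultimately have "(\<Sum>i\<in>S. x $ i) < w"
      by linarith
    with F show "p \<in> ?D"
      unfolding p F_def by auto
  qed
  ultimately show ?thesis by simp
qed

text \<open>The core depends on the samples only through the largest demand \<open>m\<close> on each
  coalition, so violation by \<open>S\<close> is the preimage of a Borel set under a measurable map
  into a Euclidean space. \<open>X\<close> and \<open>Y\<close> are general in order to cover a
  random multi-sample with a fresh point as well as a fixed multi-sample.\<close>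

lemma measurable_core_violation:
  fixes u :: "'n::finite set \<Rightarrow> 'a \<Rightarrow> real"
  assumes J: "finite J" and X: "\<And>l. l \<in> J \<Longrightarrow> (\<lambda>p. X p l) \<in> measurable N M"
    and Y: "Y \<in> measurable N M"
    and u: "\<And>S. S \<in> proper_coalitions \<Longrightarrow> u S \<in> borel_measurable M"
    and \<S>: "\<S> \<subseteq> proper_coalitions"
  shows "Measurable.pred N (\<lambda>p. core_violated u (restricted_core u uN J (X p)) \<S> (Y p))"
proof -
  \<comment> \<open>Only these coalitions are constrained by a label in \<open>J\<close>. For the
    others the maximum would range over the empty set; the value 0 that \<open>m\<close> takes there
    is never compared with anything.\<close>
  define \<T> where "\<T> = {T \<in> proper_coalitions. \<exists>l\<in>J. fst l \<in> T}"
  define m where "m p = (\<chi> T. if T \<in> \<T> then MAX l\<in>{l \<in> J. fst l \<in> T}. u T (X p l) else 0)" for p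
  have m: "m \<in> borel_measurable N"
  proof (subst borel_measurable_euclidean_space, rule ballI)
    fix b :: "real^'n set" assume "b \<in> Basis"
    then obtain T where b: "b = axis T 1" by (auto simp: Basis_vec_def)
    have "(\<lambda>p. if T \<in> \<T> then MAX l\<in>{l \<in> J. fst l \<in> T}. u T (X p l) else 0) \<in> borel_measurable N"
    proof (cases "T \<in> \<T>")
      case True
      then have "u T \<in> borel_measurable M" using u by (simp add: \<T>_def)
      then have "(\<lambda>p. MAX l\<in>{l \<in> J. fst l \<in> T}. u T (X p l)) \<in> borel_measurable N"
        using J X by (intro borel_measurable_Max) (auto intro: measurable_compose)
      with True show ?thesis by simp
    qed simp
    then show "(\<lambda>p. m p \<bullet> b) \<in> borel_measurable N"
      by (simp add: m_def b inner_axis)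
  qed
  have core: "x \<in> restricted_core u uN J (X p) \<longleftrightarrow>
      (\<Sum>i\<in>UNIV. x $ i) = uN \<and> (\<forall>T\<in>\<T>. m p $ T \<le> (\<Sum>i\<in>T. x $ i))" for x p
  proof -
    have "m p $ T \<le> (\<Sum>i\<in>T. x $ i) \<longleftrightarrow> (\<forall>l\<in>J. fst l \<in> T \<longrightarrow> u T (X p l) \<le> (\<Sum>i\<in>T. x $ i))"
      if "T \<in> \<T>" for T
    proof -
      have "{l \<in> J. fst l \<in> T} \<noteq> {}" using that by (auto simp: \<T>_def)
      with J that show ?thesis
        unfolding m_def by (subst vec_lambda_beta) (auto simp: Max_le_iff simp del: fst_conv)
    qed
    then show ?thesis
      unfolding restricted_core_def by (fastforce simp: \<T>_def)
  qed
  have "Measurable.pred N (\<lambda>p. \<exists>x\<in>restricted_core u uN J (X p). (\<Sum>i\<in>S. x $ i) < u S (Y p))"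
    if "S \<in> \<S>" for S
  proof -
    define D where "D = {(m, w). \<exists>x::real^'n. (\<Sum>i\<in>UNIV. x $ i) = uN \<and>
      (\<forall>T\<in>\<T>. m $ T \<le> (\<Sum>i\<in>T. x $ i)) \<and> (\<Sum>i\<in>S. x $ i) < w}"
    have D: "D \<in> sets borel"
      unfolding D_def by (rule borel_strict_polyhedron_projection)
    have "(\<lambda>p. u S (Y p)) \<in> borel_measurable N"
      using that \<S> u Y by (auto intro: measurable_compose)
    then have "(\<lambda>p. (m p, u S (Y p))) \<in> borel_measurable N"
      using m by (intro borel_measurable_Pair)
    then have "Measurable.pred N (\<lambda>p. (m p, u S (Y p)) \<in> D)"
      using D by measurable
    moreover have "(m p, u S (Y p)) \<in> D \<longleftrightarrow>
        (\<exists>x\<in>restricted_core u uN J (X p). (\<Sum>i\<in>S. x $ i) < u S (Y p))" for p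
      unfolding D_def Bex_def core by auto
    ultimately show ?thesis by simp
  qed
  then have "Measurable.pred N
      (\<lambda>p. \<exists>S\<in>\<S>. \<exists>x\<in>restricted_core u uN J (X p). (\<Sum>i\<in>S. x $ i) < u S (Y p))"
    by (intro pred_intros_finite) simp_all
  moreover have "(\<exists>S\<in>\<S>. \<exists>x\<in>restricted_core u uN J (X p). (\<Sum>i\<in>S. x $ i) < u S (Y p)) \<longleftrightarrow>
      core_violated u (restricted_core u uN J (X p)) \<S> (Y p)" for p
    unfolding core_violated_def by blast
  ultimately show ?thesis by simp
qed

lemma (in prob_space) measurable_measure_section:
  assumes "Measurable.pred (N \<Otimes>\<^sub>M M) (\<lambda>(\<xi>, \<omega>). Q \<xi> \<omega>)"
  shows "(\<lambda>\<xi>. measure M {\<omega> \<in> space M. Q \<xi> \<omega>}) \<in> borel_measurable N"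
proof -
  let ?A = "{p \<in> space (N \<Otimes>\<^sub>M M). case p of (\<xi>, \<omega>) \<Rightarrow> Q \<xi> \<omega>}"
  have "?A \<in> sets (N \<Otimes>\<^sub>M M)"
    using assms by (simp add: pred_def)
  then have "(\<lambda>\<xi>. enn2real (emeasure M (Pair \<xi> -` ?A))) \<in> borel_measurable N"
    by (intro borel_measurable_enn2real measurable_emeasure_Pair)
  moreover have "Pair \<xi> -` ?A = {\<omega> \<in> space M. Q \<xi> \<omega>}" if "\<xi> \<in> space N" for \<xi>
    using that by (auto simp: space_pair_measure)
  ultimately show ?thesis
    by (subst measurable_cong) (auto simp: measure_def)
qed

section \<open>Independence of kept and discarded samples\<close>

text \<open>The basic estimate behind compression bounds: conditionally on the coordinates in \<open>I\<close>, the
  set \<open>{\<omega>. Q \<xi> \<omega>}\<close> is fixed, and the remaining coordinates all miss it independently.\<close>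

lemma (in prob_space) prob_PiM_uncovered_le:
  fixes Q :: "('i \<Rightarrow> 'a) \<Rightarrow> 'a \<Rightarrow> bool"
  assumes fin: "finite I" "finite J" and disj: "I \<inter> J = {}"
    and Q: "Measurable.pred (PiM (I \<union> J) (\<lambda>_. M) \<Otimes>\<^sub>M M) (\<lambda>(\<xi>, \<omega>). Q \<xi> \<omega>)"
    and cong: "\<And>\<xi> \<xi>' \<omega>. (\<And>l. l \<in> I \<Longrightarrow> \<xi> l = \<xi>' l) \<Longrightarrow> Q \<xi> \<omega> \<longleftrightarrow> Q \<xi>' \<omega>"
    and e: "0 \<le> e" "e \<le> 1"
  defines "A \<equiv> {\<xi> \<in> space (PiM (I \<union> J) (\<lambda>_. M)).
                  e < measure M {\<omega> \<in> space M. Q \<xi> \<omega>} \<and> (\<forall>l\<in>J. \<not> Q \<xi> (\<xi> l))}"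
  shows "A \<in> sets (PiM (I \<union> J) (\<lambda>_. M))"
    and "measure (PiM (I \<union> J) (\<lambda>_. M)) A \<le> (1 - e) ^ card J"
proof -
  let ?P = "\<lambda>I. PiM I (\<lambda>_. M)"
  interpret P: product_prob_space "\<lambda>_. M" L for L :: "'i set" ..
  have Ql: "Measurable.pred (?P (I \<union> J)) (\<lambda>\<xi>. Q \<xi> (\<xi> l))" if "l \<in> J" for l
  proof -
    have "(\<lambda>\<xi>. (\<xi>, \<xi> l)) \<in> measurable (?P (I \<union> J)) (?P (I \<union> J) \<Otimes>\<^sub>M M)"
      using that by (intro measurable_Pair measurable_component_singleton) auto
    from measurable_compose[OF this Q] show ?thesis by simp
  qed
  have meas: "(\<lambda>\<xi>. measure M {\<omega> \<in> space M. Q \<xi> \<omega>}) \<in> borel_measurable (?P (I \<union> J))"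
    using Q by (rule measurable_measure_section)
  have "Measurable.pred (?P (I \<union> J))
      (\<lambda>\<xi>. e < measure M {\<omega> \<in> space M. Q \<xi> \<omega>} \<and> (\<forall>l\<in>J. \<not> Q \<xi> (\<xi> l)))"
    using meas Ql fin by (intro pred_intros_logic pred_intros_finite borel_measurable_pred_less) auto
  then show A: "A \<in> sets (?P (I \<union> J))"
    by (simp add: A_def pred_def)
  \<comment> \<open>By Fubini it suffices to bound each slice on which the coordinates in
    \<open>I\<close> are frozen to \<open>x\<close>.\<close>
  have slice: "emeasure (?P J) ((\<lambda>y. merge I J (x, y)) -` A \<inter> space (?P J)) \<le> ennreal ((1 - e) ^ card J)"
    if x: "x \<in> space (?P I)" for x
  proof -
    have Qx: "Q (merge I J (x, y)) \<omega> \<longleftrightarrow> Q x \<omega>" for y \<omega>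
      by (rule cong) (simp add: merge_def)
    let ?B = "{\<omega> \<in> space M. Q x \<omega>}"
    have B: "?B \<in> sets M"
    proof -
      \<comment> \<open>Joint measurability of \<open>Q\<close> concerns points of the full product,
        so \<open>x\<close> is completed by an arbitrary \<open>y\<close>, on which \<open>Q\<close>
        does not depend.\<close>
      obtain y where "y \<in> space (?P J)" using P.not_empty by blast
      then have "(\<lambda>\<omega>. (merge I J (x, y), \<omega>)) \<in> measurable M (?P (I \<union> J) \<Otimes>\<^sub>M M)"
        using x by (intro measurable_Pair measurable_const measurable_space[OF measurable_merge])
          (auto simp: space_pair_measure)
      from measurable_compose[OF this Q] show ?thesis
        by (simp add: Qx pred_def)
    qed
    show ?thesis
    proof (cases "e < measure M ?B")
      case True
      \<comment> \<open>All coordinates in \<open>J\<close> avoid the fixed set \<open>?B\<close>,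
        so the slice lies in a box, whose measure factors.\<close>
      have "(\<lambda>y. merge I J (x, y)) -` A \<inter> space (?P J) \<subseteq> {y \<in> space (?P J). \<forall>l\<in>J. y l \<in> space M - ?B}"
        using disj by (auto simp: A_def Qx space_PiM)
      then have "emeasure (?P J) ((\<lambda>y. merge I J (x, y)) -` A \<inter> space (?P J))
          \<le> emeasure (?P J) {y \<in> space (?P J). \<forall>l\<in>J. y l \<in> space M - ?B}"
        using B fin by (intro emeasure_mono) (measurable, auto)
      also have "\<dots> = (\<Prod>l\<in>J. emeasure M (space M - ?B))"
        using B fin by (intro P.emeasure_PiM_Collect) auto
      also have "\<dots> = ennreal ((1 - measure M ?B) ^ card J)"
        using B by (simp add: emeasure_eq_measure prob_compl ennreal_power)
      also have "\<dots> \<le> ennreal ((1 - e) ^ card J)"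
        using True by (intro ennreal_leI power_mono) auto
      finally show ?thesis .
    next
      case False
      then have "(\<lambda>y. merge I J (x, y)) -` A \<inter> space (?P J) = {}"
        by (auto simp: A_def Qx)
      then show ?thesis by simp
    qed
  qed
  have "emeasure (?P (I \<union> J)) A
      = (\<integral>\<^sup>+x. emeasure (?P J) ((\<lambda>y. merge I J (x, y)) -` A \<inter> space (?P J)) \<partial>?P I)"
    by (rule P.emeasure_fold_integral[OF disj fin A])
  also have "\<dots> \<le> (\<integral>\<^sup>+x. ennreal ((1 - e) ^ card J) \<partial>?P I)"
    by (intro nn_integral_mono slice)
  also have "\<dots> = ennreal ((1 - e) ^ card J)"
    by (simp add: P.emeasure_space_1)
  finally show "measure (?P (I \<union> J)) A \<le> (1 - e) ^ card J"
    using e by (simp add: P.emeasure_eq_measure)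
qed

section \<open>Counting index sets and comparing cores\<close>

text \<open>Grouping by cardinality turns the union bound over retained index sets into the binomial
  sum that defines \<open>b i\<close>.\<close>

lemma sum_subsets_by_card:
  fixes f :: "nat \<Rightarrow> real"
  assumes "finite A"
  shows "(\<Sum>I | I \<subseteq> A \<and> card I < card A. f (card I)) = (\<Sum>k<card A. real (card A choose k) * f k)"
proof -
  let ?X = "{I. I \<subseteq> A \<and> card I < card A}"
  have "(\<Sum>I\<in>?X. f (card I)) = (\<Sum>k<card A. \<Sum>I | I \<in> ?X \<and> card I = k. f (card I))"
    using assms by (intro sum.group[symmetric]) auto
  also have "\<dots> = (\<Sum>k<card A. real (card A choose k) * f k)"
  proof (rule sum.cong[OF refl])
    fix k assume "k \<in> {..<card A}"
    then have "{I. I \<in> ?X \<and> card I = k} = {I. I \<subseteq> A \<and> card I = k}" by auto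
    then show "(\<Sum>I | I \<in> ?X \<and> card I = k. f (card I)) = real (card A choose k) * f k"
      using n_subsets[OF assms, of k] by simp
  qed
  finally show ?thesis .
qed

lemma finite_sample_labels: "finite (sample_labels K)"
  by (simp add: sample_labels_def)

lemma restricted_core_antimono:
  "I \<subseteq> J \<Longrightarrow> restricted_core u uN J \<xi> \<subseteq> restricted_core u uN I \<xi>"
  unfolding restricted_core_def by blast

lemma restricted_core_cong:
  assumes "\<And>l. l \<in> J \<Longrightarrow> \<xi> l = \<xi>' l"
  shows "restricted_core u uN J \<xi> = restricted_core u uN J \<xi>'"
  using assms unfolding restricted_core_def by auto

lemma scenario_core_eq_restricted_core:
  assumes "\<And>i. 0 < K i"
  shows "scenario_core u uN K \<xi> = restricted_core u uN (sample_labels K) \<xi>"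
proof -
  have "(MAX i\<in>S. MAX k\<in>{1..K i}. u S (\<xi> (i, k))) \<le> y \<longleftrightarrow>
      (\<forall>i\<in>S. \<forall>k\<in>{1..K i}. u S (\<xi> (i, k)) \<le> y)" if "S \<in> proper_coalitions" for S y
  proof -
    have "S \<noteq> {}" "\<And>i. {1..K i} \<noteq> {}"
      using that assms by (auto simp: proper_coalitions_def Suc_le_eq)
    then show ?thesis by (simp add: Max_le_iff)
  qed
  then show ?thesis
    unfolding scenario_core_def restricted_core_def sample_labels_def by fastforce
qed

text \<open>A sample of agent \<open>i\<close> constrains exactly the proper coalitions containing
  \<open>i\<close>; this is why violations are treated agent by agent.\<close>

lemma not_core_violated_sample:
  assumes "(i, k) \<in> J"
  shows "\<not> core_violated u (restricted_core u uN J \<xi>) {S \<in> proper_coalitions. i \<in> S} (\<xi> (i, k))"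
  using assms unfolding core_violated_def restricted_core_def by force

section \<open>The violation bound for one agent\<close>

text \<open>Only the samples of agent \<open>i\<close> are compressed here: those of all the other agents are kept,
  so that \<open>restricted_core\<close> over the kept labels is independent of the discarded samples.\<close>

lemma (in prob_space) agent_violation_bound:
  fixes u :: "'n::finite set \<Rightarrow> 'a \<Rightarrow> real" and e :: "nat \<Rightarrow> real"
  assumes u: "\<And>S. S \<in> proper_coalitions \<Longrightarrow> u S \<in> borel_measurable M"
    and e: "\<And>k. k \<le> K i \<Longrightarrow> 0 \<le> e k \<and> e k \<le> 1" and e_last: "e (K i) = 1"
  shows "\<exists>B\<in>sets (multisample_measure M K).
    measure (multisample_measure M K) B
      \<le> (\<Sum>k<K i. real (K i choose k) * (1 - e k) ^ (K i - k)) \<and>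
    (\<forall>\<xi>\<in>space (multisample_measure M K) - B. \<forall>I\<subseteq>{1..K i}.
       restricted_core u uN (sample_labels K - {i} \<times> ({1..K i} - I)) \<xi>
         = restricted_core u uN (sample_labels K) \<xi> \<longrightarrow>
       measure M {\<omega> \<in> space M. core_violated u (restricted_core u uN (sample_labels K) \<xi>)
         {S \<in> proper_coalitions. i \<in> S} \<omega>} \<le> e (card I))"
proof -
  let ?L = "sample_labels K" and ?P = "multisample_measure M K"
  let ?\<S> = "{S \<in> proper_coalitions. i \<in> S}"
  define D where "D I = {i} \<times> ({1..K i} - I)" for I
  define Q where "Q I \<xi> \<omega> \<longleftrightarrow> core_violated u (restricted_core u uN (?L - D I) \<xi>) ?\<S> \<omega>" for I \<xi> \<omega>
  \<comment> \<open>The bad event for \<open>I\<close>: the core from the kept labels has too large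
    a violation probability, yet no discarded sample reveals it.\<close>
  define E where "E I = {\<xi> \<in> space ?P. e (card I) < measure M {\<omega> \<in> space M. Q I \<xi> \<omega>} \<and>
      (\<forall>l\<in>D I. \<not> Q I \<xi> (\<xi> l))}" for I
  \<comment> \<open>The full index set is left out: nothing is discarded there, and
    \<open>e (K i) = 1\<close> makes the bound trivial.\<close>
  define \<I> where "\<I> = {I. I \<subseteq> {1..K i} \<and> card I < K i}"
  interpret P: prob_space ?P
    unfolding multisample_measure_def by (intro prob_space_PiM prob_space_axioms)
  have E: "E I \<in> sets ?P" "measure ?P (E I) \<le> (1 - e (card I)) ^ (K i - card I)" if "I \<in> \<I>" for I
  proof -
    have I: "I \<subseteq> {1..K i}" "card I < K i" using that by (auto simp: \<I>_def)
    have DL: "?L - D I \<union> D I = ?L"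
      by (auto simp: D_def sample_labels_def)
    have card_D: "card (D I) = K i - card I"
      using I by (simp add: D_def card_cartesian_product_singleton card_Diff_subset finite_subset)
    have pred: "Measurable.pred (PiM (?L - D I \<union> D I) (\<lambda>_. M) \<Otimes>\<^sub>M M) (\<lambda>(\<xi>, \<omega>). Q I \<xi> \<omega>)"
      unfolding DL case_prod_beta Q_def
      by (rule measurable_core_violation[where M=M])
        (auto simp: finite_sample_labels u intro!: measurable_compose[OF measurable_fst])
    have cong: "Q I \<xi> \<omega> \<longleftrightarrow> Q I \<xi>' \<omega>" if "\<And>l. l \<in> ?L - D I \<Longrightarrow> \<xi> l = \<xi>' l" for \<xi> \<xi>' \<omega>
      unfolding Q_def by (subst restricted_core_cong[where \<xi>'=\<xi>']) (use that in auto)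
    have fin: "finite (?L - D I)" "finite (D I)"
      by (auto simp: finite_sample_labels D_def)
    have eI: "0 \<le> e (card I)" "e (card I) \<le> 1"
      using e I by auto
    have disj: "(?L - D I) \<inter> D I = {}" by blast
    note bound = prob_PiM_uncovered_le[OF fin disj pred cong eI, unfolded DL card_D]
    show "E I \<in> sets ?P" "measure ?P (E I) \<le> (1 - e (card I)) ^ (K i - card I)"
      unfolding E_def multisample_measure_def by (rule bound, assumption)+
  qed
  have fin: "finite \<I>" by (simp add: \<I>_def)
  show ?thesis
  proof (intro bexI conjI ballI allI impI)
    show "(\<Union>I\<in>\<I>. E I) \<in> sets ?P"
      using E fin by auto
    have "measure ?P (\<Union>I\<in>\<I>. E I) \<le> (\<Sum>I\<in>\<I>. measure ?P (E I))"
      using E fin by (intro P.finite_measure_subadditive_finite) auto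
    also have "\<dots> \<le> (\<Sum>I\<in>\<I>. (1 - e (card I)) ^ (K i - card I))"
      by (intro sum_mono E)
    also have "\<dots> = (\<Sum>k<K i. real (K i choose k) * (1 - e k) ^ (K i - k))"
      using sum_subsets_by_card[of "{1..K i}" "\<lambda>k. (1 - e k) ^ (K i - k)"] by (simp add: \<I>_def)
    finally show "measure ?P (\<Union>I\<in>\<I>. E I) \<le> \<dots>" .
  next
    fix \<xi> I
    assume \<xi>: "\<xi> \<in> space ?P - (\<Union>I\<in>\<I>. E I)" and I: "I \<subseteq> {1..K i}"
      and "restricted_core u uN (?L - {i} \<times> ({1..K i} - I)) \<xi> = restricted_core u uN ?L \<xi>"
    then have Q: "Q I \<xi> \<omega> \<longleftrightarrow> core_violated u (restricted_core u uN ?L \<xi>) ?\<S> \<omega>" for \<omega>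
      by (simp add: Q_def D_def)
    show "measure M {\<omega> \<in> space M. core_violated u (restricted_core u uN ?L \<xi>) ?\<S> \<omega>} \<le> e (card I)"
    proof (cases "card I < K i")
      case True
      then have "\<xi> \<notin> E I" using \<xi> I by (auto simp: \<I>_def)
      \<comment> \<open>Without loss in the compression, \<open>Q I\<close> speaks of the full core,
        which satisfies the constraints of all samples, the discarded ones included. Being outside
        \<open>E I\<close> therefore forces the violation probability down.\<close>
      moreover have "\<not> Q I \<xi> (\<xi> l)" if "l \<in> D I" for l
        using that not_core_violated_sample[of i "snd l" ?L u uN \<xi>] unfolding Q
        by (auto simp: D_def sample_labels_def)
      ultimately show ?thesis
        using \<xi> by (auto simp: E_def Q)
    next
      case False
      moreover have "card I \<le> K i" using card_mono[OF _ I] by simp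
      ultimately show ?thesis using e_last by simp
    qed
  qed
qed

section \<open>Combining the agents\<close>

text \<open>A proper coalition is nonempty, so each violated one is counted for at least one of its
  members; the rest is subadditivity.\<close>

lemma (in prob_space) core_instability_le_sum_agents:
  assumes u: "\<And>S. S \<in> proper_coalitions \<Longrightarrow> u S \<in> borel_measurable M"
    and J: "finite J" "\<And>l. l \<in> J \<Longrightarrow> \<xi> l \<in> space M"
  shows "core_instability M u (restricted_core u uN J \<xi>)
    \<le> (\<Sum>i\<in>UNIV. measure M {\<omega> \<in> space M.
         core_violated u (restricted_core u uN J \<xi>) {S \<in> proper_coalitions. i \<in> S} \<omega>})"
proof -
  let ?V = "\<lambda>i. {\<omega> \<in> space M.
      core_violated u (restricted_core u uN J \<xi>) {S \<in> proper_coalitions. i \<in> S} \<omega>}"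
  have V: "?V i \<in> sets M" for i
    unfolding pred_def[symmetric]
    by (rule measurable_core_violation[where X="\<lambda>_. \<xi>" and M=M]) (auto simp: J u)
  have "core_instability M u (restricted_core u uN J \<xi>) \<le> measure M (\<Union>i. ?V i)"
    unfolding core_instability_def
  proof (rule finite_measure_mono)
    show "{\<omega> \<in> space M. \<exists>x\<in>restricted_core u uN J \<xi>. \<exists>S\<in>proper_coalitions. (\<Sum>i\<in>S. x $ i) < u S \<omega>}
        \<subseteq> (\<Union>i. ?V i)"
    proof
      fix \<omega>
      assume "\<omega> \<in> {\<omega> \<in> space M. \<exists>x\<in>restricted_core u uN J \<xi>. \<exists>S\<in>proper_coalitions. (\<Sum>i\<in>S. x $ i) < u S \<omega>}"
      then obtain x S where "\<omega> \<in> space M" "x \<in> restricted_core u uN J \<xi>" "S \<in> proper_coalitions"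
        "(\<Sum>i\<in>S. x $ i) < u S \<omega>"
        by blast
      moreover from this obtain i where "i \<in> S"
        by (auto simp: proper_coalitions_def)
      ultimately show "\<omega> \<in> (\<Union>i. ?V i)"
        unfolding core_violated_def by blast
    qed
  qed (use V in auto)
  also have "\<dots> \<le> (\<Sum>i\<in>UNIV. measure M (?V i))"
    using V by (intro finite_measure_subadditive_finite) auto
  finally show ?thesis .
qed

theorem theorem1:
  fixes M :: "'a measure"
    and u :: "'n::finite set \<Rightarrow> 'a \<Rightarrow> real" and uN :: real
    and K :: "'n \<Rightarrow> nat"
    and \<beta> :: real and b :: "'n \<Rightarrow> real"
    and \<epsilon> :: "'n \<Rightarrow> nat \<Rightarrow> real"
    and sel :: "('n \<times> nat \<Rightarrow> 'a) \<Rightarrow> ('n \<times> nat) set"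
  assumes "prob_space M"
    and "\<And>S. S \<in> proper_coalitions \<Longrightarrow> u S \<in> borel_measurable M"
    and "\<And>\<xi>. \<xi> \<in> space (multisample_measure M K) \<Longrightarrow> scenario_core u uN K \<xi> \<noteq> {}"
    and "0 < \<beta>" and "\<beta> < 1"
    and "\<And>i. 0 < b i" and "(\<Sum>i\<in>UNIV. b i) = \<beta>"
    and "\<And>i k. k \<le> K i \<Longrightarrow> 0 \<le> \<epsilon> i k \<and> \<epsilon> i k \<le> 1"
    and "\<And>i. \<epsilon> i (K i) = 1"
    and "\<And>i. (\<Sum>k<K i. real (K i choose k) * (1 - \<epsilon> i k) ^ (K i - k)) = b i"
    and "\<And>\<xi>. \<xi> \<in> space (multisample_measure M K) \<Longrightarrow> sel \<xi> \<subseteq> sample_labels K"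
    and "AE \<xi> in multisample_measure M K.
           restricted_core u uN (sel \<xi>) \<xi> = scenario_core u uN K \<xi>"
    and "\<And>i. (\<lambda>\<xi>. agent_count (sel \<xi>) i) \<in> measurable (multisample_measure M K) (count_space UNIV)"
  shows "measure (multisample_measure M K)
           {\<xi> \<in> space (multisample_measure M K).
              core_instability M u (scenario_core u uN K \<xi>)
                \<le> (\<Sum>i\<in>UNIV. \<epsilon> i (agent_count (sel \<xi>) i))} \<ge> 1 - \<beta>"
proof -
  interpret prob_space M by fact
  let ?L = "sample_labels K" and ?P = "multisample_measure M K"
  note u = assms(2) and b_pos = assms(6) and b_sum = assms(7) and e = assms(8) and e_last = assms(9)
    and b_eq = assms(10) and sel = assms(11) and sel_core = assms(12) and count = assms(13)
  interpret P: prob_space ?P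
    unfolding multisample_measure_def by (intro prob_space_PiM assms(1))
  \<comment> \<open>With no samples the binomial sum would be empty, contradicting
    \<open>0 < b i\<close>. Positivity makes the maxima in the scenario core range over nonempty
    sets.\<close>
  have "K i \<noteq> 0" for i
    using b_pos[of i] b_eq[of i] by (cases "K i = 0") auto
  then have core: "scenario_core u uN K \<xi> = restricted_core u uN ?L \<xi>" for \<xi>
    by (intro scenario_core_eq_restricted_core) simp
  let ?G = "{\<xi> \<in> space ?P. core_instability M u (scenario_core u uN K \<xi>)
      \<le> (\<Sum>i\<in>UNIV. \<epsilon> i (agent_count (sel \<xi>) i))}"
  define bounded where "bounded i B \<longleftrightarrow> (\<forall>\<xi>\<in>space ?P - B. \<forall>I\<subseteq>{1..K i}.
        restricted_core u uN (?L - {i} \<times> ({1..K i} - I)) \<xi> = restricted_core u uN ?L \<xi> \<longrightarrow>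
        measure M {\<omega> \<in> space M. core_violated u (restricted_core u uN ?L \<xi>)
          {S \<in> proper_coalitions. i \<in> S} \<omega>} \<le> \<epsilon> i (card I))" for i B
  have "\<exists>B\<in>sets ?P. measure ?P B \<le> b i \<and> bounded i B" for i
    using agent_violation_bound[where u=u and K=K and uN=uN and i=i and e="\<epsilon> i", OF u e e_last]
    unfolding b_eq bounded_def .
  then obtain B where B: "\<And>i. B i \<in> sets ?P" "\<And>i. measure ?P (B i) \<le> b i"
    and B_bounded: "\<And>i. bounded i (B i)"
    by metis
  have G: "?G \<in> sets ?P"
  proof -
    have "(\<lambda>\<xi>. core_instability M u (scenario_core u uN K \<xi>)) \<in> borel_measurable ?P"
      unfolding core core_instability_def core_violated_def[symmetric]
      by (intro measurable_measure_section, unfold case_prod_beta multisample_measure_def,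
          rule measurable_core_violation[where M=M])
        (auto simp: finite_sample_labels u intro!: measurable_compose[OF measurable_fst])
    moreover have "(\<lambda>\<xi>. \<epsilon> i (agent_count (sel \<xi>) i)) \<in> borel_measurable ?P" for i
      by (rule measurable_compose[OF count]) simp
    ultimately show ?thesis
      by (intro borel_measurable_le borel_measurable_sum)
  qed
  have good: "\<xi> \<in> ?G" if \<xi>: "\<xi> \<in> space ?P" "\<And>i. \<xi> \<notin> B i"
    and eq: "restricted_core u uN (sel \<xi>) \<xi> = scenario_core u uN K \<xi>" for \<xi>
  proof -
    have "measure M {\<omega> \<in> space M. core_violated u (restricted_core u uN ?L \<xi>)
        {S \<in> proper_coalitions. i \<in> S} \<omega>} \<le> \<epsilon> i (agent_count (sel \<xi>) i)" for i
      unfolding agent_count_def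
    proof (rule B_bounded[unfolded bounded_def, rule_format])
      let ?I = "{k. (i, k) \<in> sel \<xi>}"
      show "\<xi> \<in> space ?P - B i" using \<xi> by simp
      show "?I \<subseteq> {1..K i}" using sel[OF \<xi>(1)] by (auto simp: sample_labels_def)
      \<comment> \<open>The kept labels lie between \<open>sel \<xi>\<close> and all labels. The two
        outer cores agree, so antimonotonicity squeezes the core in between.\<close>
      have "sel \<xi> \<subseteq> ?L - {i} \<times> ({1..K i} - ?I)" using sel[OF \<xi>(1)] by auto
      from restricted_core_antimono[OF this, of u uN \<xi>]
      show "restricted_core u uN (?L - {i} \<times> ({1..K i} - ?I)) \<xi> = restricted_core u uN ?L \<xi>"
        using restricted_core_antimono[of "?L - {i} \<times> ({1..K i} - ?I)" ?L u uN \<xi>]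
        unfolding eq core by blast
    qed
    then have "(\<Sum>i\<in>UNIV. measure M {\<omega> \<in> space M. core_violated u (restricted_core u uN ?L \<xi>)
        {S \<in> proper_coalitions. i \<in> S} \<omega>}) \<le> (\<Sum>i\<in>UNIV. \<epsilon> i (agent_count (sel \<xi>) i))"
      by (rule sum_mono)
    moreover have "core_instability M u (restricted_core u uN ?L \<xi>)
        \<le> (\<Sum>i\<in>UNIV. measure M {\<omega> \<in> space M. core_violated u (restricted_core u uN ?L \<xi>)
            {S \<in> proper_coalitions. i \<in> S} \<omega>})"
      using \<xi>(1) by (intro core_instability_le_sum_agents u finite_sample_labels)
        (auto simp: multisample_measure_def space_PiM)
    ultimately show ?thesis using \<xi>(1) by (simp add: core)
  qed
  have "measure ?P (space ?P - ?G) \<le> measure ?P (\<Union>i. B i)"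
    
  proof (rule P.finite_measure_mono_AE)
    \<comment> \<open>The selected labels reproduce the core only almost surely, so the complement
      of the good event lies in the union of the \<open>B i\<close> up to a null set.\<close>
    show "AE \<xi> in ?P. \<xi> \<in> space ?P - ?G \<longrightarrow> \<xi> \<in> (\<Union>i. B i)"
      using sel_core
    proof eventually_elim
      case (elim \<xi>)
      then show ?case using good[of \<xi>] by blast
    qed
  qed (use B(1) in auto)
  also have "\<dots> \<le> (\<Sum>i\<in>UNIV. measure ?P (B i))"
    using B(1) by (intro P.finite_measure_subadditive_finite) auto
  also have "\<dots> \<le> \<beta>"
    unfolding b_sum[symmetric] by (intro sum_mono B)
  finally show ?thesis
    using P.prob_compl[OF G] by linarith
qed

end
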